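(* Let $T\in\mathbb{C}^{m\times n}$ be a partial isometry and let $A\in\mathbb{C}^{m\times n}$. Then the following are equivalent: (i) $A$ is $T$-EP (i.e., $\mathcal{R}(A)=\mathcal{R}(TA^*T)$ and $A=AT^*T$); (ii) $\mathcal{R}(A)=\mathcal{R}(TA^*T)$ and $\mathcal{N}(T)\subseteq\mathcal{N}(A)$; (iii) $\mathcal{N}(A^* )=\mathcal{N}(T^*AT^* )$ and $\mathcal{R}(A^* )\subseteq\mathcal{R}(T^* )$; (iv) $\mathcal{R}(A)=\mathcal{R}(TA^* )$ and $\mathcal{N}(T)\subseteq\mathcal{N}(A)$; (v) $\mathcal{R}(A)=\mathcal{R}(TA^* )$ and $A=AT^*T$; (vi) $\mathcal{N}(A^* )=\mathcal{N}(AT^* )$ and $\mathcal{R}(A^* )\subseteq\mathcal{R}(T^* )$.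
   Context: $\mathcal{R}(\cdot)$ and $\mathcal{N}(\cdot)$ denote the range space and null space, and $^*$ the conjugate transpose. $T$ is a partial isometry if $T=TT^*T$. $A$ is $T$-EP if $\mathcal{R}(A)=\mathcal{R}(TA^*T)$ and $A=AT^*T$. *)

theory Defs
  imports "HOL-Analysis.Analysis"
begin

(* The type complex^'n^'m stands for the m x n matrices (m rows, n columns);
   such a matrix maps complex^'n to complex^'m. *)

definition conj_transpose :: "complex^'n^'m \<Rightarrow> complex^'m^'n" ("(_\<^sup>H)" [1000] 999)
  where "A\<^sup>H = (\<chi> i j. cnj (A $ j $ i))"

definition range_space :: "complex^'n^'m \<Rightarrow> (complex^'m) set"
  where "range_space A = range (\<lambda>x. A *v x)"

definition null_space :: "complex^'n^'m \<Rightarrow> (complex^'n) set"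
  where "null_space A = {x. A *v x = 0}"

definition partial_isometry :: "complex^'n^'m \<Rightarrow> bool"
  where "partial_isometry T \<longleftrightarrow> T = T ** T\<^sup>H ** T"

definition T_EP :: "complex^'n^'m \<Rightarrow> complex^'n^'m \<Rightarrow> bool"
  where "T_EP T A \<longleftrightarrow> range_space A = range_space (T ** A\<^sup>H ** T) \<and> A = A ** T\<^sup>H ** T"

end

theory Submission
  imports Defs
begin

text \<open>
  Both hypotheses that accompany the range and null space equations are the same condition in
  different forms: as \<open>T\<close> is a partial isometry, \<open>T\<^sup>H ** T\<close> is the orthogonal projection along
  \<open>null_space T\<close>, so \<open>A = A ** T\<^sup>H ** T\<close> says that \<open>A\<close> vanishes on \<open>null_space T\<close>, and by taking
  orthogonal complements this says that \<open>range_space (A\<^sup>H) \<subseteq> range_space (T\<^sup>H)\<close>.  Likewise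
  null space equations are range equations for the conjugate transposes.  All this duality is the
  identity \<open>null_space M = (range_space (M\<^sup>H))\<^sup>\<bottom>\<close>, for which the real inner product (the real
  part of the Hermitian one) suffices.

  What remains is that, when \<open>A = A ** T\<^sup>H ** T\<close>, the matrices \<open>T ** A\<^sup>H ** T\<close> and \<open>T ** A\<^sup>H\<close>
  may replace each other in the range equation.  Put \<open>S = T ** A\<^sup>H\<close>.  Then \<open>A\<close> has the same range
  as \<open>A ** T\<^sup>H = S\<^sup>H\<close>, so the two equations read
  \<open>range_space (S\<^sup>H) = range_space (S ** T)\<close> and \<open>range_space (S\<^sup>H) = range_space S\<close>.
  The first gives \<open>range_space (S\<^sup>H) \<subseteq> range_space S\<close>, which in finite dimension is already an
  equality (lemma \<open>range_space_conj_transpose_eqI\<close>).  Conversely, if \<open>S\<close> and \<open>S\<^sup>H\<close> have the same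
  range, then \<open>S\<close> maps its own range, which lies in that of \<open>T\<close>, onto
  \<open>range_space (S ** S\<^sup>H) = range_space S\<close>, so \<open>S ** T\<close> has the same range as \<open>S\<close>.
\<close>

lemma conj_transpose_conj_transpose [simp]: "(M\<^sup>H)\<^sup>H = M"
  by (simp add: conj_transpose_def vec_eq_iff)

lemma conj_transpose_mult: "(M ** N)\<^sup>H = N\<^sup>H ** M\<^sup>H"
  by (simp add: conj_transpose_def matrix_matrix_mult_def vec_eq_iff mult.commute)

lemma linear_matrix_vector_mult_complex:
  fixes M :: "complex^'n^'m"
  shows "linear ((*v) M)"
proof (rule linearI)
  fix c :: real and x :: "complex^'n"
  show "M *v (c *\<^sub>R x) = c *\<^sub>R (M *v x)"
    by (simp add: matrix_vector_mult_def vec_eq_iff scaleR_sum_right)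
qed (rule matrix_vector_right_distrib)

text \<open>
  The conjugate transpose is the adjoint even for the real inner product, which makes the
  orthogonal complements of real Euclidean spaces available for complex matrices.
\<close>

lemma inner_matrix_vector_mult:
  fixes M :: "complex^'n^'m"
  shows "(M *v x) \<bullet> y = x \<bullet> (M\<^sup>H *v y)"
proof -
  have inner_eq: "a \<bullet> b = Re (a * cnj b)" for a b :: complex
    by (simp add: inner_complex_def)
  have "(M *v x) \<bullet> y = Re (\<Sum>i\<in>UNIV. \<Sum>j\<in>UNIV. M $ i $ j * x $ j * cnj (y $ i))"
    by (simp add: inner_vec_def inner_eq matrix_vector_mult_def sum_distrib_right)
  also have "\<dots> = Re (\<Sum>j\<in>UNIV. \<Sum>i\<in>UNIV. M $ i $ j * x $ j * cnj (y $ i))"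
    by (subst sum.swap) (rule refl)
  also have "\<dots> = x \<bullet> (M\<^sup>H *v y)"
    by (simp add: inner_vec_def inner_eq matrix_vector_mult_def conj_transpose_def
        sum_distrib_left mult_ac)
  finally show ?thesis .
qed

lemma subspace_range_space: "subspace (range_space M)"
  unfolding range_space_def
  by (rule linear_subspace_image[OF linear_matrix_vector_mult_complex subspace_UNIV])

lemma range_space_mult: "range_space (M ** N) = (*v) M ` range_space N"
  by (simp add: range_space_def image_image matrix_vector_mul_assoc)

lemma range_space_mult_subset: "range_space (M ** N) \<subseteq> range_space M"
  unfolding range_space_mult by (auto simp: range_space_def)

lemma null_space_eq_orthogonal_comp: "null_space M = (range_space (M\<^sup>H))\<^sup>\<bottom>"
proof -
  have "M *v x = 0 \<longleftrightarrow> (\<forall>y. (M\<^sup>H *v y) \<bullet> x = 0)" for x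
    by (metis inner_matrix_vector_mult conj_transpose_conj_transpose inner_eq_zero_iff
        inner_zero_right)
  then show ?thesis
    by (auto simp: null_space_def range_space_def orthogonal_comp_def orthogonal_def)
qed

lemma null_space_subset_iff:
  "null_space M \<subseteq> null_space N \<longleftrightarrow> range_space (N\<^sup>H) \<subseteq> range_space (M\<^sup>H)"
  unfolding null_space_eq_orthogonal_comp
  by (metis orthogonal_comp_anti_mono orthogonal_comp_self subspace_range_space)

lemma range_space_eq_iff_null_space:
  "range_space M = range_space N \<longleftrightarrow> null_space (M\<^sup>H) = null_space (N\<^sup>H)"
  using null_space_subset_iff[of "M\<^sup>H" "N\<^sup>H"] null_space_subset_iff[of "N\<^sup>H" "M\<^sup>H"] by auto

text \<open>A vector killed by \<open>S ** S\<^sup>H\<close> has an image under \<open>S\<^sup>H\<close> that is orthogonal to itself.\<close>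

lemma range_space_mult_conj_transpose: "range_space (S ** S\<^sup>H) = range_space S"
proof -
  have "S\<^sup>H *v x = 0" if "S *v (S\<^sup>H *v x) = 0" for x
    using inner_matrix_vector_mult[of S "S\<^sup>H *v x" x] that by simp
  then have "null_space (S ** S\<^sup>H) = null_space (S\<^sup>H)"
    by (auto simp: null_space_def matrix_vector_mul_assoc[symmetric] matrix_vector_mult_0_right)
  then show ?thesis
    by (simp add: range_space_eq_iff_null_space conj_transpose_mult)
qed

text \<open>
  The range of \<open>S\<close> meets the null space of \<open>S\<^sup>H\<close> trivially, so \<open>S\<^sup>H\<close> is injective on
  \<open>range_space S\<close>.  If it also maps this finite-dimensional space into itself, it maps it onto itself.
\<close>

lemma range_space_conj_transpose_eqI:
  fixes S :: "complex^'n^'n"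
  assumes "range_space (S\<^sup>H) \<subseteq> range_space S"
  shows "range_space (S\<^sup>H) = range_space S"
proof -
  let ?U = "range_space S"
  have "inj_on ((*v) (S\<^sup>H)) ?U"
  proof (rule linear_inj_on_iff_eq_0[OF linear_matrix_vector_mult_complex subspace_range_space,
        THEN iffD2], intro ballI impI)
    fix x assume "x \<in> ?U" "S\<^sup>H *v x = 0"
    then obtain y where y: "x = S *v y" by (auto simp: range_space_def)
    have "x \<bullet> x = y \<bullet> (S\<^sup>H *v x)"
      by (metis y inner_matrix_vector_mult)
    then show "x = 0" using \<open>S\<^sup>H *v x = 0\<close> by simp
  qed
  then have "dim ((*v) (S\<^sup>H) ` ?U) = dim ?U"
    by (intro dim_image_eq linear_matrix_vector_mult_complex)
      (simp add: span_eq_iff[THEN iffD2] subspace_range_space)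
  then have "dim (range_space (S\<^sup>H ** S)) = dim ?U"
    by (simp add: range_space_mult)
  moreover have "range_space (S\<^sup>H ** S) = range_space (S\<^sup>H)"
    using range_space_mult_conj_transpose[of "S\<^sup>H"] by simp
  ultimately show ?thesis
    using assms by (intro subspace_dim_equal subspace_range_space) simp_all
qed

text \<open>
  The vector \<open>x - T\<^sup>H *v (T *v x)\<close> lies in \<open>null_space T\<close> because \<open>T\<close> is a partial isometry, so a
  matrix that vanishes there does not distinguish \<open>x\<close> from \<open>T\<^sup>H *v (T *v x)\<close>.
\<close>

lemma null_space_subset_iff_eq_mult:
  assumes "partial_isometry T"
  shows "null_space T \<subseteq> null_space A \<longleftrightarrow> A = A ** T\<^sup>H ** T"
proof
  assume sub: "null_space T \<subseteq> null_space A"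
  have T: "T *v (T\<^sup>H *v (T *v x)) = T *v x" for x
    using assms unfolding partial_isometry_def by (metis matrix_vector_mul_assoc)
  have "A *v x = (A ** T\<^sup>H ** T) *v x" for x
  proof -
    have "x - T\<^sup>H *v (T *v x) \<in> null_space T"
      by (simp add: null_space_def matrix_vector_mult_diff_distrib T)
    then have "x - T\<^sup>H *v (T *v x) \<in> null_space A"
      using sub by blast
    then show ?thesis
      by (simp add: null_space_def matrix_vector_mult_diff_distrib matrix_vector_mul_assoc
          matrix_mul_assoc)
  qed
  then show "A = A ** T\<^sup>H ** T"
    by (simp add: matrix_eq)
next
  assume "A = A ** T\<^sup>H ** T"
  then show "null_space T \<subseteq> null_space A"
    unfolding null_space_def
    by (metis (mono_tags, lifting) Collect_mono matrix_vector_mul_assoc matrix_vector_mult_0_right)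
qed

text \<open>
  With \<open>S = T ** A\<^sup>H\<close>, both range equations are comparisons with \<open>range_space (S\<^sup>H)\<close>, and each says
  that \<open>S\<close> and \<open>S\<^sup>H\<close> have the same range.
\<close>

lemma range_space_eq_iff_drop_factor:
  assumes A: "A = A ** T\<^sup>H ** T"
  shows "range_space A = range_space (T ** A\<^sup>H ** T) \<longleftrightarrow> range_space A = range_space (T ** A\<^sup>H)"
proof -
  define S where "S = T ** A\<^sup>H"
  have SH: "S\<^sup>H = A ** T\<^sup>H"
    by (simp add: S_def conj_transpose_mult)
  have RA: "range_space A = range_space (S\<^sup>H)"
    using range_space_mult_subset[of "A ** T\<^sup>H" T] range_space_mult_subset[of A "T\<^sup>H"] A SH
    by simp
  have "range_space (S\<^sup>H) = range_space (S ** T) \<longleftrightarrow> range_space (S\<^sup>H) = range_space S"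
  proof
    assume "range_space (S\<^sup>H) = range_space (S ** T)"
    then show "range_space (S\<^sup>H) = range_space S"
      using range_space_mult_subset[of S T] by (intro range_space_conj_transpose_eqI) simp
  next
    assume eq: "range_space (S\<^sup>H) = range_space S"
    have "range_space S = (*v) S ` range_space S"
      using range_space_mult_conj_transpose[of S] eq by (simp add: range_space_mult)
    also have "\<dots> \<subseteq> (*v) S ` range_space T"
      unfolding S_def by (intro image_mono range_space_mult_subset)
    also have "\<dots> = range_space (S ** T)"
      by (simp add: range_space_mult)
    finally show "range_space (S\<^sup>H) = range_space (S ** T)"
      using eq range_space_mult_subset[of S T] by blast
  qed
  then show ?thesis
    by (simp add: RA S_def[symmetric])
qed

theorem theorem2p13:
  fixes T A :: "complex^'n^'m"
  assumes "partial_isometry T"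
  shows "(T_EP T A \<longleftrightarrow>
            range_space A = range_space (T ** A\<^sup>H ** T) \<and> null_space T \<subseteq> null_space A)
       \<and> (T_EP T A \<longleftrightarrow>
            null_space (A\<^sup>H) = null_space (T\<^sup>H ** A ** T\<^sup>H) \<and> range_space (A\<^sup>H) \<subseteq> range_space (T\<^sup>H))
       \<and> (T_EP T A \<longleftrightarrow>
            range_space A = range_space (T ** A\<^sup>H) \<and> null_space T \<subseteq> null_space A)
       \<and> (T_EP T A \<longleftrightarrow>
            range_space A = range_space (T ** A\<^sup>H) \<and> A = A ** T\<^sup>H ** T)
       \<and> (T_EP T A \<longleftrightarrow>
            null_space (A\<^sup>H) = null_space (A ** T\<^sup>H) \<and> range_space (A\<^sup>H) \<subseteq> range_space (T\<^sup>H))"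
proof -
  note incl = null_space_subset_iff_eq_mult[OF assms, of A]
  have incl_dual: "range_space (A\<^sup>H) \<subseteq> range_space (T\<^sup>H) \<longleftrightarrow> A = A ** T\<^sup>H ** T"
    using incl null_space_subset_iff by blast
  have dual3: "null_space (A\<^sup>H) = null_space (T\<^sup>H ** A ** T\<^sup>H)
      \<longleftrightarrow> range_space A = range_space (T ** A\<^sup>H ** T)"
    by (simp add: range_space_eq_iff_null_space conj_transpose_mult matrix_mul_assoc)
  have dual2: "null_space (A\<^sup>H) = null_space (A ** T\<^sup>H) \<longleftrightarrow> range_space A = range_space (T ** A\<^sup>H)"
    by (simp add: range_space_eq_iff_null_space conj_transpose_mult)
  show ?thesis
    unfolding T_EP_def incl incl_dual dual3 dual2
    using range_space_eq_iff_drop_factor[of A T] by blast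
qed

end
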